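(* Suppose that $n\equiv 1\pmod 4$ and $n\notin\{9,25\}$. Then $$\sum_{k=1}^{n-1}\frac{F_{kn}}{F_k}\equiv 0\pmod{F_n}$$ holds true if and only if $n$ is prime.
   Context: Here $n$ denotes a positive integer, and $(F_m)_{m\ge 0}$ is the Fibonacci sequence: $F_0=0$, $F_1=1$, $F_{m+1}=F_m+F_{m-1}$ for $m\ge 1$. Each quotient $F_{kn}/F_k$ with $k\ge 1$ is an integer, since $F_k\mid F_{kn}$.
   Formalization: The formal theorem assumes in addition n > 1: at n = 1 the sum is empty and hence 0 modulo F_1 = 1, but 1 is not prime, so the claim as written fails for that single value. *)

theory Defs
  imports "HOL-Number_Theory.Number_Theory"
begin

end

theory Submission
  imports Defs
begin

text \<open>
  Put \<open>d = gcd(k, n)\<close>. Since \<open>gcd(F\<^sub>k, F\<^sub>n) = F\<^sub>d\<close>, the summand \<open>F\<^bsub>kn\<^esub>/F\<^sub>k\<close> is a multiple of \<open>F\<^sub>n/F\<^sub>d\<close>; for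
  prime \<open>n\<close> this makes every summand divisible by \<open>F\<^sub>n\<close>. If \<open>n\<close> is composite with least prime factor
  \<open>p\<close> and \<open>D = n/p\<close>, each of the \<open>p - 1\<close> summands with \<open>d = D\<close> equals \<open>F\<^sub>n/F\<^sub>D\<close> times an integer
  congruent to \<open>\<plusminus>D\<close> modulo \<open>F\<^sub>D\<close>, with a sign not depending on \<open>k\<close> (here \<open>n \<equiv> 1 (mod 4)\<close> is used).
  If \<open>F\<^sub>n\<close> divided the sum, then \<open>F\<^sub>D/L\<close> would divide \<open>D(p - 1)\<close>, where \<open>L\<close> is the least common multiple
  of the \<open>F\<^sub>e\<close> for proper divisors \<open>e\<close> of \<open>D\<close>. By inclusion-exclusion for gcd and lcm,
  \<open>F\<^sub>D/L\<close> is the product of \<open>F\<^bsub>D/s\<^esub>\<close> to the power \<open>\<mu>(s)\<close> over \<open>s dvd D\<close>, which by Binet's formula is at least \<open>\<alpha>\<close> to the power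
  \<open>totient D\<close> divided by \<open>exp 1\<close>, where \<open>\<alpha>\<close> is the golden ratio. This exceeds \<open>D\<^sup>2\<close> once \<open>totient D \<ge> 22\<close>, and the few remaining odd \<open>D\<close>
  are checked individually.
\<close>

subsection \<open>Quotients of Fibonacci numbers\<close>

lemma fib_add_int:
  "int (fib (m + n)) = int (fib m) * int (fib (n + 1)) + int (fib (m + 1)) * int (fib n)
     - int (fib m) * int (fib n)"
proof (cases m)
  case (Suc l)
  then show ?thesis
    using fib_add[of l n] by (simp add: algebra_simps)
qed simp

lemma fib_dvd_fib_mult: "fib m dvd fib (m * n)"
  by (metis dvd_triv_left fib_gcd gcd.commute gcd_nat.absorb_iff2 gcd_dvd2)

lemma fib_dvd_mono: "m dvd n \<Longrightarrow> fib m dvd fib n"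
  by (metis dvd_def fib_dvd_fib_mult)

text \<open>Modulo \<open>fib m\<close> the addition formula loses one product, so raising the index
  by \<open>m\<close> multiplies by \<open>fib (m + 1)\<close>.\<close>

lemma fib_mult_plus_1_cong:
  "[int (fib (m * n + 1)) = int (fib (m + 1)) ^ n] (mod int (fib m))"
proof (induction n)
  case (Suc n)
  have "fib (m * Suc n + 1) = fib (m + 1) * fib (m * n + 1) + fib m * fib (m * n)"
    using fib_add[of "m * n" m] by (simp add: algebra_simps)
  then have "[int (fib (m * Suc n + 1)) = int (fib (m + 1)) * int (fib (m * n + 1))] (mod int (fib m))"
    by (simp add: cong_iff_dvd_diff)
  also have "[int (fib (m + 1)) * int (fib (m * n + 1)) = int (fib (m + 1)) * int (fib (m + 1)) ^ n]
      (mod int (fib m))"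
    by (intro cong_mult Suc.IH cong_refl)
  finally show ?case by simp
qed simp

text \<open>Cancelling \<open>fib m\<close> in the addition formula gives a recurrence for the
  quotients; modulo \<open>fib m\<close> it is the recurrence of n x^(n-1) with x = F_(m+1). At
  \<open>n = 0\<close> the truncated exponent is harmless, as the factor \<open>n\<close>
  vanishes.\<close>

lemma fib_mult_div_cong:
  assumes "m > 0"
  shows "[int (fib (m * n) div fib m) = int n * int (fib (m + 1)) ^ (n - 1)] (mod int (fib m))"
proof (induction n)
  case (Suc n)
  let ?q = "\<lambda>n. int (fib (m * n) div fib m)"
  have pos: "int (fib m) \<noteq> 0" using assms fib_neq_0_nat by simp
  have q: "int (fib (m * n)) = int (fib m) * ?q n" for n
    by (metis dvd_mult_div_cancel fib_dvd_fib_mult of_nat_mult)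
  have "int (fib m) * ?q (Suc n)
      = int (fib m) * (?q n * int (fib (m + 1)) + int (fib (m * n + 1)) - int (fib m) * ?q n)"
    using fib_add_int[of "m * n" m]
    unfolding q[symmetric] by (simp add: q algebra_simps)
  then have "?q (Suc n) = ?q n * int (fib (m + 1)) + int (fib (m * n + 1)) - int (fib m) * ?q n"
    using pos by simp
  then have "[?q (Suc n) = ?q n * int (fib (m + 1)) + int (fib (m * n + 1))] (mod int (fib m))"
    by (simp add: cong_iff_dvd_diff)
  also have "[?q n * int (fib (m + 1)) + int (fib (m * n + 1))
      = int n * int (fib (m + 1)) ^ (n - 1) * int (fib (m + 1)) + int (fib (m + 1)) ^ n] (mod int (fib m))"
    by (intro cong_add cong_mult Suc.IH cong_refl fib_mult_plus_1_cong)
  also have "int n * int (fib (m + 1)) ^ (n - 1) * int (fib (m + 1)) + int (fib (m + 1)) ^ n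
      = int (Suc n) * int (fib (m + 1)) ^ (Suc n - 1)"
    by (cases n) (auto simp: algebra_simps)
  finally show ?case .
qed simp

text \<open>Turns a Bezout relation between indices into a linear relation between Fibonacci
  numbers.\<close>

lemma fib_dOcagne:
  "int (fib (m + k)) * int (fib (k + 1)) - int (fib (m + k + 1)) * int (fib k) = (-1) ^ k * int (fib m)"
  by (induction k) (auto simp: algebra_simps)

text \<open>Cassini's identity at odd index: F_(d+1) is a square root of -1 modulo F_d, so its even
  powers are signs.\<close>

lemma fib_Suc_square_cong:
  assumes "odd d"
  shows "[int (fib (d + 1)) ^ 2 = -1] (mod int (fib d))"
proof -
  have "int (fib (d + 1)) ^ 2 - (-1) = int (fib d) * int (fib (d + 2))"
    using fib_Cassini_int[of d] assms by (simp add: algebra_simps)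
  then show ?thesis by (simp add: cong_iff_dvd_diff)
qed

lemma gcd_Lcm_dvd:
  fixes a :: nat
  assumes "finite X" and "\<And>x. x \<in> X \<Longrightarrow> gcd a x dvd L"
  shows "gcd a (Lcm X) dvd L"
  using assms
proof (induction X rule: finite_induct)
  case (insert x X)
  then show ?case
    by (simp add: gcd_lcm_distrib)
qed simp

text \<open>F_k F_n is gcd times lcm, the gcd is F_gcd(k,n), and the lcm divides F_(kn); cancel
  F_k.\<close>

lemma fib_dvd_quotient_mult_fib_gcd:
  assumes "k > 0"
  shows "fib n dvd fib (k * n) div fib k * fib (gcd k n)"
proof -
  have pos: "fib k > 0" using assms by (rule fib_neq_0_nat)
  have "fib k * (fib (k * n) div fib k) = fib (k * n)"
    by (simp add: fib_dvd_fib_mult)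
  then have "fib k * (fib (k * n) div fib k * fib (gcd k n)) = fib (gcd k n) * fib (k * n)"
    by (simp flip: mult.assoc)
  moreover have "fib k * fib n = fib (gcd k n) * lcm (fib k) (fib n)"
    by (simp add: fib_gcd flip: prod_gcd_lcm_nat)
  moreover have "lcm (fib k) (fib n) dvd fib (k * n)"
    by (simp add: fib_dvd_mono)
  ultimately have "fib k * fib n dvd fib k * (fib (k * n) div fib k * fib (gcd k n))"
    by (simp only: mult_dvd_mono dvd_refl)
  then show ?thesis using pos by simp
qed

text \<open>Passing from the modulus F_(di) to its divisor F_d expresses the residues for all
  \<open>i\<close> through the single number F_(d+1).\<close>

lemma fib_mult_div_cong_dvd:
  assumes "d > 0" and "i > 0"
  shows "[int (fib (d * i * t) div fib (d * i)) = int t * int (fib (d + 1)) ^ (i * (t - 1))] (mod int (fib d))"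
proof -
  have "[int (fib (d * i * t) div fib (d * i)) = int t * int (fib (d * i + 1)) ^ (t - 1)] (mod int (fib (d * i)))"
    using assms by (intro fib_mult_div_cong) simp
  then have "[int (fib (d * i * t) div fib (d * i)) = int t * int (fib (d * i + 1)) ^ (t - 1)] (mod int (fib d))"
    by (rule cong_dvd_modulus) (simp add: fib_dvd_fib_mult)
  also have "[int t * int (fib (d * i + 1)) ^ (t - 1) = int t * (int (fib (d + 1)) ^ i) ^ (t - 1)] (mod int (fib d))"
    by (intro cong_mult cong_pow cong_refl fib_mult_plus_1_cong)
  finally show ?thesis by (simp add: power_mult)
qed

text \<open>
  If \<open>a m = b j + 1\<close>, then d'Ocagne's identity writes \<open>\<plusminus>F\<^sub>d\<close> as a combination of \<open>F\<^sub>n\<close> and \<open>F\<^sub>k\<close>.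
  Multiplying it by \<open>R\<close> expresses \<open>R\<close> through quotients \<open>F\<^sub>s\<^sub>t / F\<^sub>s\<close> with \<open>d dvd s\<close>, whose residues
  are known. Solving \<open>R F\<^sub>k / F\<^sub>d = F\<^sub>k\<^sub>n / F\<^sub>n\<close> for \<open>R\<close> directly would require
  \<open>j\<close> to be a unit modulo \<open>F\<^sub>d\<close>.
\<close>
lemma fib_quotient_cong:
  fixes d m j :: nat
  defines "n \<equiv> d * m" and "k \<equiv> d * j"
  assumes "j > 0" and "coprime j m" and n: "n mod 4 = 1"
  obtains R where "fib (k * n) div fib k * fib d = fib n * R"
    and "[int R = (-1) ^ ((m - 1) div 2) * int d] (mod int (fib d))"
proof -
  have "odd n" using n by presburger
  then have "odd d" "odd m" by (auto simp: n_def)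
  then have d: "d > 0" and m: "m > 0" by (auto intro: Nat.gr0I)
  have "k > 0" using d \<open>j > 0\<close> by (simp add: k_def)
  have pos: "fib d > 0" "fib n > 0" "fib k > 0"
    using d m \<open>j > 0\<close> by (auto simp: n_def k_def intro!: fib_neq_0_nat)
  have gcd: "gcd k n = d"
    using \<open>coprime j m\<close> gcd_mult_distrib_nat[of d j m]
    unfolding n_def k_def coprime_iff_gcd_eq_1 by simp
  define Q where "Q = fib (k * n) div fib k"
  define Q' where "Q' = fib (n * k) div fib n"
  have Q: "fib (k * n) = fib k * Q" and Q': "fib (k * n) = fib n * Q'"
    by (simp_all add: Q_def Q'_def fib_dvd_mono mult.commute[of n k])
  obtain R where RQ: "Q * fib d = fib n * R"
    using fib_dvd_quotient_mult_fib_gcd[OF \<open>k > 0\<close>, of n] unfolding gcd Q_def by (rule dvdE)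
  \<comment> \<open>Computing F_(kn) F_d in two ways shows that the same \<open>R\<close> also
    serves the companion quotient \<open>Q'\<close>.\<close>
  have "fib n * (Q' * fib d) = fib (k * n) * fib d" using Q' by simp
  also have "\<dots> = fib k * (Q * fib d)" using Q by simp
  also have "\<dots> = fib n * (fib k * R)" unfolding RQ by (rule mult.left_commute)
  finally have "fib n * (Q' * fib d) = fib n * (fib k * R)" .
  then have RQ': "Q' * fib d = fib k * R" using pos by simp
  obtain a b where ab: "m * a = j * b + 1"
    using bezout_nat[of m j] m \<open>coprime j m\<close>
    by (metis coprime_commute coprime_imp_gcd_eq_1 less_numeral_extra(3))
  then have "a > 0" by (intro Nat.gr0I) simp
  have an: "n * a = d + k * b"
    using ab by (simp add: n_def k_def mult.assoc)
  define A where "A = fib (n * a) div fib n"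
  define B where "B = fib (k * b) div fib k"
  have A: "fib (n * a) = fib n * A" and B: "fib (k * b) = fib k * B"
    by (simp_all add: A_def B_def fib_dvd_mono)
  \<comment> \<open>d'Ocagne at the indices \<open>n * a = d + k * b\<close>, multiplied by
    \<open>R\<close>. Both products then contain F_d, which cancels.\<close>
  have "int (fib d) * ((-1) ^ (k * b) * int R)
      = (int (fib (d + k * b)) * int (fib (k * b + 1)) - int (fib (d + k * b + 1)) * int (fib (k * b))) * int R"
    by (subst fib_dOcagne) simp
  also have "\<dots> = (int (fib n * R) * int A * int (fib (k * b + 1)) - int (fib (n * a + 1)) * int (fib k * R) * int B)"
    unfolding an[symmetric] A B by (simp add: algebra_simps)
  also have "\<dots> = int (fib d) * (int Q * int A * int (fib (k * b + 1)) - int (fib (n * a + 1)) * int Q' * int B)"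
    unfolding RQ[symmetric] RQ'[symmetric] by (simp add: algebra_simps)
  finally have id: "(-1) ^ (k * b) * int R
      = int Q * int A * int (fib (k * b + 1)) - int (fib (n * a + 1)) * int Q' * int B"
    using pos by simp
  define u where "u = int (fib (d + 1))"
  define e where "e = j * (n - 1) + m * (a - 1) + j * b"
  have "[(-1) ^ (k * b) * int R
      = (int n * u ^ (j * (n - 1))) * (int a * u ^ (m * (a - 1))) * u ^ (j * b)
        - u ^ (m * a) * (int k * u ^ (m * (k - 1))) * (int b * u ^ (j * (b - 1)))] (mod int (fib d))"
    unfolding id unfolding u_def Q_def Q'_def A_def B_def n_def k_def
    using d m \<open>j > 0\<close> fib_mult_plus_1_cong[of d "j * b"] fib_mult_plus_1_cong[of d "m * a"]
    by (intro cong_diff cong_mult fib_mult_div_cong_dvd) (simp_all add: mult.assoc)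
  also have "(int n * u ^ (j * (n - 1))) * (int a * u ^ (m * (a - 1))) * u ^ (j * b)
      = int (n * a) * u ^ e"
    by (simp add: e_def power_add algebra_simps)
  \<comment> \<open>Both terms carry the same power of \<open>u\<close> because
    \<open>j * n = m * k\<close>. For \<open>b = 0\<close> the exponents may differ, but the term is
    zero.\<close>
  also have "u ^ (m * a) * (int k * u ^ (m * (k - 1))) * (int b * u ^ (j * (b - 1)))
      = int (k * b) * u ^ e"
  proof (cases "b = 0")
    case False
    have "j * (n - 1) + j = m * (k - 1) + m"
      using d m \<open>j > 0\<close> by (simp add: n_def k_def diff_mult_distrib2)
    moreover have "j * (b - 1) + j = j * b" "m * (a - 1) + m = m * a"
      using False \<open>a > 0\<close> by (simp_all add: diff_mult_distrib2)
    ultimately have "e = m * a + m * (k - 1) + j * (b - 1)"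
      unfolding e_def by linarith
    then show ?thesis by (simp add: power_add)
  qed simp
  also have "int (n * a) * u ^ e - int (k * b) * u ^ e = int d * u ^ e"
    unfolding an by (simp add: algebra_simps)
  finally have 1: "[(-1) ^ (k * b) * int R = int d * u ^ e] (mod int (fib d))" .
  define s where "s = (m - 1) div 2"
  define t where "t = n div 4"
  have ms: "m = 2 * s + 1" and nt: "n - 1 = 4 * t"
    using \<open>odd m\<close> n by (auto simp: s_def t_def elim!: oddE, presburger)
  have "m * (a - 1) + m = m * a" using \<open>a > 0\<close> by (simp add: diff_mult_distrib2)
  \<comment> \<open>Since 4 divides \<open>n - 1\<close>, it contributes an even amount to
    \<open>e / 2\<close>, so the parity of \<open>e / 2\<close> is that of
    \<open>s + j * b\<close>.\<close>
  then have es: "e + 2 * s = 2 * (2 * t * j + j * b)"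
    using ab ms unfolding e_def nt by (simp add: algebra_simps)
  then obtain r where r: "e = 2 * r" by (metis dvd_add_left_iff dvd_triv_left dvdE)
  then have "r + s = 2 * (t * j) + j * b" using es by simp
  then have rs: "(-1 :: int) ^ r = (-1) ^ s * (-1) ^ (j * b)"
    by (metis (no_types, opaque_lifting) minus_one_power_iff even_add even_mult_iff even_numeral mult.commute mult_minus1_right mult_1 power_add)
  have "[u ^ e = (-1) ^ r] (mod int (fib d))"
    unfolding r power_mult u_def by (intro cong_pow fib_Suc_square_cong \<open>odd d\<close>)
  then have "[int d * u ^ e = int d * ((-1) ^ s * (-1) ^ (j * b))] (mod int (fib d))"
    unfolding rs by (intro cong_mult cong_refl)
  with 1 have "[(-1) ^ (k * b) * int R = int d * ((-1) ^ s * (-1) ^ (j * b))] (mod int (fib d))"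
    by (rule cong_trans)
  moreover have "(-1 :: int) ^ (k * b) = (-1) ^ (j * b)"
    using \<open>odd d\<close> by (auto simp: minus_one_power_iff k_def)
  ultimately have "[(-1) ^ (j * b) * ((-1) ^ (j * b) * int R)
      = (-1) ^ (j * b) * (int d * ((-1) ^ s * (-1) ^ (j * b)))] (mod int (fib d))"
    by (intro cong_scalar_left) simp
  then have "[int R = (-1) ^ s * int d] (mod int (fib d))"
    by (simp add: minus_one_power_iff split: if_splits)
  then show thesis
    using that RQ unfolding Q_def s_def by blast
qed

text \<open>Multiplying the sum by the lcm \<open>M\<close> of F_d over the proper divisors
  \<open>d\<close> of \<open>n\<close> other than \<open>D\<close> makes all summands with
  \<open>D\<close> not dividing \<open>k\<close> vanish modulo F_n. The other \<open>p - 1\<close>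
  summands have known residues with a common sign, so they cannot cancel each other.\<close>

lemma fib_dvd_of_fib_dvd_sum:
  fixes n p D L :: nat
  assumes "prime p" and n: "n = D * p" and n4: "n mod 4 = 1"
    and L: "\<And>e. e dvd D \<Longrightarrow> e < D \<Longrightarrow> fib e dvd L"
    and dvd: "fib n dvd (\<Sum>k=1..n-1. fib (k * n) div fib k)"
  shows "fib D dvd L * (D * (p - 1))"
proof -
  define Q where "Q = (\<lambda>k. fib (k * n) div fib k)"
  define X where "X = {d. d dvd n \<and> d < n \<and> d \<noteq> D}"
  define M where "M = Lcm (fib ` X)"
  have D: "D > 0" "n > 0" using n n4 by (auto intro: Nat.gr0I)
  have fin: "finite X" unfolding X_def by simp
  have "\<exists>R. \<forall>j\<in>{1..p-1}. Q (D * j) * fib D = fib n * R j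
      \<and> [int (R j) = (-1) ^ ((p - 1) div 2) * int D] (mod int (fib D))"
  proof (intro bchoice ballI)
    fix j assume j: "j \<in> {1..p-1}"
    then have "j > 0" "j < p" by auto
    then have "coprime j p"
      using \<open>prime p\<close> by (metis coprime_commute nat_dvd_not_less prime_imp_coprime)
    then show "\<exists>R. Q (D * j) * fib D = fib n * R \<and> [int R = (-1) ^ ((p - 1) div 2) * int D] (mod int (fib D))"
      using fib_quotient_cong[of j p D] \<open>j > 0\<close> n n4 unfolding Q_def by metis
  qed
  then obtain R where R: "\<And>j. j \<in> {1..p-1} \<Longrightarrow> Q (D * j) * fib D = fib n * R j"
    and R': "\<And>j. j \<in> {1..p-1} \<Longrightarrow> [int (R j) = (-1) ^ ((p - 1) div 2) * int D] (mod int (fib D))"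
    by blast
  have multiples: "{k \<in> {1..n-1}. D dvd k} = (\<lambda>j. D * j) ` {1..p-1}"
  proof (intro equalityI subsetI)
    fix k assume "k \<in> {k \<in> {1..n-1}. D dvd k}"
    then obtain j where j: "k = D * j" "0 < k" "k < n" using D by auto
    then have "j \<in> {1..p-1}" using n by (cases "j = 0") auto
    then show "k \<in> (\<lambda>j. D * j) ` {1..p-1}" using j by blast
  next
    fix k assume "k \<in> (\<lambda>j. D * j) ` {1..p-1}"
    then obtain j where j: "k = D * j" and "j \<in> {1..p-1}" by blast
    then have "j > 0" "j < p" by auto
    then have "0 < k" "k < n" using D(1) by (simp_all add: j n)
    then show "k \<in> {k \<in> {1..n-1}. D dvd k}" unfolding j by simp
  qed
  have rest: "fib n dvd Q k * M" if "k \<in> {k \<in> {1..n-1}. \<not> D dvd k}" for k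
  proof -
    have "k > 0" "k < n" using that by auto
    then have "gcd k n < n" using gcd_le1_nat[of k n] by linarith
    moreover have "gcd k n \<noteq> D" using that by (metis gcd_dvd1 mem_Collect_eq)
    ultimately have "gcd k n \<in> X" by (simp add: X_def)
    then have "Q k * fib (gcd k n) dvd Q k * M" unfolding M_def by (intro mult_dvd_mono) auto
    then show ?thesis
      using fib_dvd_quotient_mult_fib_gcd[OF \<open>k > 0\<close>, of n] unfolding Q_def by (rule dvd_trans[rotated])
  qed
  have "sum Q {1..n-1} = sum Q {k \<in> {1..n-1}. D dvd k} + sum Q {k \<in> {1..n-1}. \<not> D dvd k}"
    by (subst sum.union_disjoint[symmetric]) (auto intro!: arg_cong[where f = "sum Q"])
  also have "sum Q {k \<in> {1..n-1}. D dvd k} = (\<Sum>j=1..p-1. Q (D * j))"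
    unfolding multiples using D by (subst sum.reindex) (auto simp: inj_on_def)
  finally have "fib n dvd (\<Sum>j=1..p-1. Q (D * j)) * M + (\<Sum>k | k \<in> {1..n-1} \<and> \<not> D dvd k. Q k * M)"
    using dvd unfolding Q_def[symmetric] by (metis distrib_right dvd_mult2 sum_distrib_right)
  moreover have "fib n dvd (\<Sum>k | k \<in> {1..n-1} \<and> \<not> D dvd k. Q k * M)"
    using rest by (intro dvd_sum) auto
  ultimately have "fib n dvd (\<Sum>j=1..p-1. Q (D * j)) * M"
    using dvd_add_left_iff by blast
  then have "fib n * fib D dvd (\<Sum>j=1..p-1. Q (D * j)) * M * fib D"
    by (intro mult_dvd_mono dvd_refl)
  also have "\<dots> = (\<Sum>j=1..p-1. Q (D * j) * fib D) * M"
    unfolding sum_distrib_right[symmetric] by (simp add: mult_ac)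
  also have "\<dots> = fib n * ((\<Sum>j=1..p-1. R j) * M)"
    using R by (simp add: sum_distrib_left mult.assoc)
  finally have "fib D dvd (\<Sum>j=1..p-1. R j) * M"
    using fib_neq_0_nat[OF D(2)] by simp
  then have "int (fib D) dvd (\<Sum>j=1..p-1. int (R j)) * int M"
    by (metis of_nat_dvd_iff of_nat_mult of_nat_sum)
  moreover have "[(\<Sum>j=1..p-1. int (R j)) = (\<Sum>j=1..p-1. (-1) ^ ((p - 1) div 2) * int D)] (mod int (fib D))"
    using R' by (intro cong_sum) auto
  then have "[(\<Sum>j=1..p-1. int (R j)) * int M = (\<Sum>j=1..p-1. (-1) ^ ((p - 1) div 2) * int D) * int M] (mod int (fib D))"
    by (rule cong_scalar_right)
  ultimately have "int (fib D) dvd (\<Sum>j=1..p-1. (-1) ^ ((p - 1) div 2) * int D) * int M"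
    using cong_dvd_iff by blast
  also have "(\<Sum>j=1..p-1. (-1) ^ ((p - 1) div 2) * int D) * int M = (-1) ^ ((p - 1) div 2) * int (M * (D * (p - 1)))"
    by simp
  finally have "int (fib D) dvd int (M * (D * (p - 1)))"
    by (simp add: minus_one_power_iff split: if_splits)
  then have "fib D dvd M * (D * (p - 1))" by (simp only: of_nat_dvd_iff)
  \<comment> \<open>Only the part of \<open>M\<close> shared with F_D matters; it reduces to the
    proper divisors of \<open>D\<close>.\<close>
  then have "fib D dvd gcd (fib D * (D * (p - 1))) (M * (D * (p - 1)))" by simp
  also have "\<dots> = gcd (fib D) M * (D * (p - 1))"
    by (metis gcd_mult_distrib_nat mult.commute)
  finally have "fib D dvd gcd (fib D) M * (D * (p - 1))" .
  moreover have "gcd (fib D) M dvd L"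
    unfolding M_def
  proof (rule gcd_Lcm_dvd)
    fix x assume "x \<in> fib ` X"
    then obtain d where d: "x = fib d" "d dvd n" "d < n" "d \<noteq> D" by (auto simp: X_def)
    \<comment> \<open>As \<open>p\<close> is prime, the only multiples of \<open>D\<close> dividing
      \<open>n\<close> are \<open>D\<close> and \<open>n\<close>.\<close>
    have "\<not> D dvd d"
    proof
      assume "D dvd d"
      then obtain c where c: "d = D * c" by (rule dvdE)
      then have "c dvd p" using d(2) D unfolding n by simp
      then show False using \<open>prime p\<close> c d n by (auto simp: prime_nat_iff)
    qed
    then have "gcd D d \<noteq> D" by (metis gcd_dvd2)
    then have "gcd D d < D" using D by (simp add: dvd_imp_le le_neq_implies_less)
    then show "gcd (fib D) x dvd L"
      using L[of "gcd D d"] d by (simp add: fib_gcd)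
  qed (use fin in simp)
  ultimately show ?thesis by (meson dvd_trans mult_dvd_mono dvd_refl)
qed

subsection \<open>The primitive part of a Fibonacci number of odd index\<close>

lemma gcd_Lcm_image:
  fixes a :: nat
  assumes "finite X"
  shows "gcd a (Lcm (f ` X)) = Lcm ((\<lambda>x. gcd a (f x)) ` X)"
  using assms by (induction X rule: finite_induct) (simp_all add: gcd_lcm_distrib)

section \<open>Binet's formula at odd indices, in logarithmic form\<close>

definition golden :: real where "golden = (1 + sqrt 5) / 2"

lemma golden_square: "golden ^ 2 = golden + 1"
  by (simp add: golden_def power2_eq_square field_simps)

lemma golden_gt: "golden > 1.618"
proof -
  have "sqrt 5 > 2.236" by (rule real_less_rsqrt) (simp add: power2_eq_square)
  then show ?thesis by (simp add: golden_def)
qed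

lemma golden_pos [simp]: "golden > 0"
  using golden_gt by simp

text \<open>The conjugate root is \<open>- (1 / golden)\<close>, and an odd exponent makes both
  terms of Binet's formula positive.\<close>

lemma fib_odd_eq_golden:
  assumes "odd d"
  shows "real (fib d) = golden ^ d * (1 + (1 / golden ^ 2) ^ d) / sqrt 5"
proof -
  have "golden * (golden - 1) = 1"
    using golden_square by (simp add: power2_eq_square algebra_simps)
  then have "1 / golden = golden - 1"
    by (metis golden_pos less_irrefl mult.commute nonzero_divide_eq_eq)
  then have "(1 - sqrt 5) / 2 = - (1 / golden)"
    by (simp add: golden_def field_simps)
  then have "real (fib d) = (golden ^ d + (1 / golden) ^ d) / sqrt 5"
    using fib_closed_form[of d] assms unfolding golden_def[symmetric] by simp
  also have "(1 / golden) ^ d = golden ^ d * (1 / golden ^ 2) ^ d"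
    by (simp flip: power_mult_distrib add: power2_eq_square)
  finally show ?thesis by (simp add: algebra_simps)
qed

lemma ln_fib_odd_approx:
  assumes "odd d"
  shows "\<bar>ln (real (fib d)) - (real d * ln golden - ln (sqrt 5))\<bar> \<le> (1 / golden ^ 2) ^ d"
proof -
  let ?x = "(1 / golden ^ 2) ^ d"
  have x: "?x > 0" by (intro zero_less_power divide_pos_pos) simp_all
  have "ln (real (fib d)) = real d * ln golden + ln (1 + ?x) - ln (sqrt 5)"
    unfolding fib_odd_eq_golden[OF assms] using x
    by (subst ln_divide_pos, simp_all add: ln_mult_pos ln_realpow add_pos_pos)
  moreover have "0 \<le> ln (1 + ?x)" "ln (1 + ?x) \<le> ?x"
    using x by (simp_all add: ln_add_one_self_le_self)
  ultimately show ?thesis by simp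
qed

text \<open>One step of inclusion-exclusion: gcd times lcm for F_(D/q) and the old lcm, with the gcd
  distributed over that lcm using gcd(D/q, D/r) = D/(qr).\<close>

lemma Lcm_fib_insert:
  fixes D q :: nat
  assumes "finite P" and "D > 0" and "prime q" and "q \<notin> P"
    and P: "\<And>r. r \<in> insert q P \<Longrightarrow> prime r \<and> r dvd D"
  shows "Lcm ((\<lambda>r. fib (D div r)) ` insert q P) * Lcm ((\<lambda>r. fib (D div q div r)) ` P)
       = fib (D div q) * Lcm ((\<lambda>r. fib (D div r)) ` P)"
proof -
  have "gcd (fib (D div q)) (fib (D div r)) = fib (D div q div r)" if "r \<in> P" for r
  proof -
    have "coprime q r"
      using that assms by (intro primes_coprime) auto
    then have "q * r dvd D"
      using that P by (intro divides_mult) auto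
    then obtain E where D: "D = q * r * E" by (auto elim: dvdE)
    have qr: "q > 0" "r > 0" using that P prime_gt_0_nat by auto
    have "D = q * (r * E)" "D = r * (q * E)" by (simp_all add: D)
    then have "D div q = r * E" "D div r = q * E"
      using qr by (metis less_irrefl nonzero_mult_div_cancel_left)+
    moreover have "gcd (r * E) (q * E) = E"
      using \<open>coprime q r\<close> gcd_mult_distrib_nat[of E r q]
      by (metis coprime_commute coprime_imp_gcd_eq_1 mult.commute mult.right_neutral)
    ultimately have "gcd (D div q) (D div r) = E" "D div q div r = E"
      using qr by simp_all
    then show ?thesis by (metis fib_gcd)
  qed
  then have "gcd (fib (D div q)) (Lcm ((\<lambda>r. fib (D div r)) ` P)) = Lcm ((\<lambda>r. fib (D div q div r)) ` P)"
    using \<open>finite P\<close> by (simp add: gcd_Lcm_image cong: image_cong)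
  then show ?thesis
    using prod_gcd_lcm_nat[of "fib (D div q)" "Lcm ((\<lambda>r. fib (D div r)) ` P)"] by (simp add: mult.commute)
qed

lemma Lcm_fib_pos:
  fixes D :: nat
  assumes "finite P" and "D > 0" and "\<And>r. r \<in> P \<Longrightarrow> r dvd D"
  shows "Lcm ((\<lambda>r. fib (D div r)) ` P) > 0"
proof -
  have "fib (D div r) \<noteq> 0" if "r \<in> P" for r
    using fib_neq_0_nat[of "D div r"] assms(2) assms(3)[OF that] by (auto elim!: dvdE)
  then have "0 \<notin> (\<lambda>r. fib (D div r)) ` P" by force
  then show ?thesis
    using \<open>finite P\<close> by (metis Lcm_0_iff finite_imageI gr0I)
qed

text \<open>The indices of the error terms that inclusion-exclusion over the primes in \<open>P\<close> collects.\<close>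
definition cofactor_divisors :: "nat set \<Rightarrow> nat \<Rightarrow> nat set" where
  "cofactor_divisors P D = {e. e dvd D \<and> (\<forall>r. prime r \<longrightarrow> r dvd D div e \<longrightarrow> r \<in> P)}"

lemma finite_cofactor_divisors: "D > 0 \<Longrightarrow> finite (cofactor_divisors P D)"
  by (simp add: cofactor_divisors_def)

text \<open>The sets are told apart by whether \<open>q\<close> divides \<open>D div e\<close>.
  Hence no error term is counted twice when the bounds at \<open>D\<close> and
  \<open>D div q\<close> are added.\<close>

lemma cofactor_divisors_insert:
  assumes "D > 0" and "prime q" and "q dvd D" and "q \<notin> P"
  shows "cofactor_divisors P D \<inter> cofactor_divisors P (D div q) = {}"
    and "cofactor_divisors P D \<union> cofactor_divisors P (D div q) \<subseteq> cofactor_divisors (insert q P) D"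
proof -
  have q: "q > 0" using assms prime_gt_0_nat by auto
  have e: "D div e = q * (D div q div e)" "e dvd D" if "e dvd D div q" for e
  proof -
    obtain c where "D div q = e * c" using \<open>e dvd D div q\<close> by (rule dvdE)
    then have "D = q * (e * c)" using \<open>q dvd D\<close> by (metis dvd_mult_div_cancel)
    moreover from this have "e > 0" using \<open>D > 0\<close> by (auto intro: Nat.gr0I)
    ultimately show "D div e = q * (D div q div e)" "e dvd D"
      using q by (simp_all add: mult.left_commute)
  qed
  show "cofactor_divisors P D \<inter> cofactor_divisors P (D div q) = {}"
    using e assms by (auto simp: cofactor_divisors_def)
  show "cofactor_divisors P D \<union> cofactor_divisors P (D div q) \<subseteq> cofactor_divisors (insert q P) D"
    using e assms by (auto simp: cofactor_divisors_def prime_dvd_mult_iff dest: primes_dvd_imp_eq)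
qed

text \<open>Adding a prime \<open>q\<close> subtracts the approximation at \<open>D div q\<close>
  from that at \<open>D\<close>: the main term gains the factor 1 - 1/q, and the constant from sqrt
  5 cancels once \<open>P\<close> is nonempty. For all prime factors of \<open>D\<close> the main
  term is \<open>totient D * ln golden\<close>.\<close>

lemma ln_fib_Lcm_approx:
  fixes D :: nat
  assumes "finite P" and "odd D" and "\<And>r. r \<in> P \<Longrightarrow> prime r \<and> r dvd D"
  shows "\<bar>ln (real (fib D)) - ln (real (Lcm ((\<lambda>r. fib (D div r)) ` P)))
      - (real D * (\<Prod>r\<in>P. 1 - 1 / real r) * ln golden - (if P = {} then ln (sqrt 5) else 0))\<bar>
    \<le> (\<Sum>e\<in>cofactor_divisors P D. (1 / golden ^ 2) ^ e)"
  using assms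
proof (induction P arbitrary: D rule: finite_induct)
  case empty
  then have "D > 0" by (auto intro: Nat.gr0I)
  have "cofactor_divisors {} D = {D}"
  proof -
    have "e = D" if "e dvd D" "\<forall>r. prime r \<longrightarrow> \<not> r dvd D div e" for e
      using that \<open>D > 0\<close> by (metis dvd_mult_div_cancel mult.right_neutral prime_factor_nat)
    then show ?thesis using \<open>D > 0\<close> by (auto simp: cofactor_divisors_def dest: prime_gt_1_nat)
  qed
  then show ?case using ln_fib_odd_approx[OF \<open>odd D\<close>] by (simp only:) simp
next
  case (insert q P)
  have D: "D > 0" using insert.prems by (auto intro: Nat.gr0I)
  have q: "prime q" "q dvd D" using insert.prems by auto
  let ?L = "\<lambda>P D. Lcm ((\<lambda>r. fib (D div r)) ` P)"
  let ?M = "\<lambda>P D. real D * (\<Prod>r\<in>P. 1 - 1 / real r) * ln golden - (if P = {} then ln (sqrt 5) else 0)"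
  let ?H = "\<lambda>P D. ln (real (fib D)) - ln (real (?L P D))"
  let ?S = "\<lambda>A. \<Sum>e\<in>A. (1 / golden ^ 2) ^ e"
  have D': "odd (D div q)" "D div q > 0" "real (D div q) = real D / real q"
  proof -
    obtain c where c: "D = q * c" using q(2) by (rule dvdE)
    have "q > 0" using q prime_gt_0_nat by auto
    then show "odd (D div q)" "D div q > 0" "real (D div q) = real D / real q"
      using insert.prems(1) D by (simp_all add: c)
  qed
  have r: "r dvd D div q" if "r \<in> P" for r
  proof -
    have "coprime q r"
      using that insert q by (intro primes_coprime) auto
    moreover have "r dvd q * (D div q)" using that insert.prems q by simp
    ultimately show ?thesis by (metis coprime_commute coprime_dvd_mult_right_iff)
  qed
  have pos: "?L (insert q P) D > 0" "?L P (D div q) > 0" "?L P D > 0" "fib (D div q) > 0" "fib D > 0"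
    using insert D D' r q by (auto intro!: Lcm_fib_pos fib_neq_0_nat simp del: image_insert Lcm_insert)
  have "real (?L (insert q P) D) * real (?L P (D div q)) = real (fib (D div q)) * real (?L P D)"
    using Lcm_fib_insert[of P D q] insert D q by (metis of_nat_mult)
  then have "ln (real (?L (insert q P) D) * real (?L P (D div q))) = ln (real (fib (D div q)) * real (?L P D))"
    by simp
  then have H: "?H (insert q P) D = ?H P D - ?H P (D div q)"
    using pos by (simp add: ln_mult_pos del: image_insert Lcm_insert)
  have M: "?M (insert q P) D = ?M P D - ?M P (D div q)"
    using insert.hyps D' by (simp add: algebra_simps)
  have "\<bar>?H (insert q P) D - ?M (insert q P) D\<bar> \<le> \<bar>?H P D - ?M P D\<bar> + \<bar>?H P (D div q) - ?M P (D div q)\<bar>"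
    unfolding H M by linarith
  also have "\<dots> \<le> ?S (cofactor_divisors P D) + ?S (cofactor_divisors P (D div q))"
    using insert.IH[of D] insert.IH[of "D div q"] insert.prems D' r by (intro add_mono) auto
  also have "\<dots> = ?S (cofactor_divisors P D \<union> cofactor_divisors P (D div q))"
    using cofactor_divisors_insert(1)[OF D q insert.hyps(2)] D D'
    by (simp add: sum.union_disjoint finite_cofactor_divisors)
  also have "\<dots> \<le> ?S (cofactor_divisors (insert q P) D)"
    using cofactor_divisors_insert(2)[OF D q insert.hyps(2)] D
    by (intro sum_mono2) (auto simp: finite_cofactor_divisors)
  finally show ?case .
qed

section \<open>Totient bounds and growth of powers of the golden ratio\<close>

lemma prod_prime_weights_ge:
  assumes "finite P" and "\<And>q. q \<in> P \<Longrightarrow> prime q \<and> odd q"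
  shows "(\<Prod>q\<in>P. real q * (1 - 1 / real q) ^ 3) \<ge> 8 / 9"
proof -
  let ?w = "\<lambda>q::nat. real q * (1 - 1 / real q) ^ 3"
  have "1 \<le> ?w q" if "q \<in> P - {3}" for q
  proof -
    have "prime q" "odd q" "q \<noteq> 3" using assms(2) that by auto
    then have "q \<ge> 5" using prime_ge_2_nat[of q] by (cases "q = 2 \<or> q = 4") auto
    then have "1 - 1 / real q \<ge> 4 / 5" by (simp add: field_simps)
    then have "(1 - 1 / real q) ^ 3 \<ge> (4 / 5) ^ 3" by (intro power_mono) auto
    then have "?w q \<ge> 5 * (4 / 5) ^ 3" using \<open>q \<ge> 5\<close> by (intro mult_mono) auto
    moreover have "1 \<le> 5 * (4 / 5 :: real) ^ 3" by (simp add: power3_eq_cube)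
    ultimately show ?thesis by linarith
  qed
  then have 1: "1 \<le> (\<Prod>q\<in>P - {3}. ?w q)" by (rule prod_ge_1)
  show ?thesis
  proof (cases "3 \<in> P")
    case True
    \<comment> \<open>The prime 3 is the only odd prime of weight below 1: 3 (2/3)^3 = 8/9.\<close>
    then have "(\<Prod>q\<in>P. ?w q) = 8 / 9 * (\<Prod>q\<in>P - {3}. ?w q)"
      using \<open>finite P\<close> by (subst prod.remove[of P 3]) (simp_all add: power3_eq_cube)
    then show ?thesis using 1 by simp
  qed (use 1 in simp)
qed

text \<open>totient(D)^3 / D^2 is D times the product of (1 - 1/q)^3; bounding D below by its
  radical leaves the product of the prime weights.\<close>

lemma odd_totient_cube_ge:
  assumes "odd D"
  shows "8 * real D ^ 2 \<le> 9 * real (totient D) ^ 3"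
proof -
  have D: "D > 0" using assms by (auto intro: Nat.gr0I)
  let ?P = "prime_factors D"
  have P: "prime q \<and> odd q" if "q \<in> ?P" for q
    using that assms by (auto simp: in_prime_factors_iff)
  have "(\<Prod>q\<in>?P. real q) \<le> (\<Prod>q\<in>?P. real q ^ multiplicity q D)"
  proof (intro prod_mono conjI)
    fix q assume q: "q \<in> ?P"
    then have "multiplicity q D > 0" by (simp add: prime_factors_multiplicity)
    then show "real q \<le> real q ^ multiplicity q D"
      using P[OF q] prime_ge_1_nat[of q] by (intro self_le_power) auto
  qed simp
  also have "\<dots> = real D"
    using prime_factorization_nat[OF D] by (metis (no_types, lifting) of_nat_power of_nat_prod prod.cong)
  finally have rad: "(\<Prod>q\<in>?P. real q) \<le> real D" .
  have nonneg: "0 \<le> (\<Prod>q\<in>?P. 1 - 1 / real q)"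
    using P prime_gt_0_nat by (intro prod_nonneg) (simp add: Suc_le_eq)
  have "8 / 9 \<le> (\<Prod>q\<in>?P. real q * (1 - 1 / real q) ^ 3)"
    using P by (intro prod_prime_weights_ge) auto
  also have "\<dots> = (\<Prod>q\<in>?P. real q) * (\<Prod>q\<in>?P. 1 - 1 / real q) ^ 3"
    by (simp add: prod.distrib prod_power_distrib)
  also have "\<dots> \<le> real D * (\<Prod>q\<in>?P. 1 - 1 / real q) ^ 3"
    using rad nonneg by (intro mult_right_mono) auto
  finally have "8 / 9 * real D ^ 2 \<le> (real D * (\<Prod>q\<in>?P. 1 - 1 / real q) ^ 3) * real D ^ 2"
    by (intro mult_right_mono) auto
  also have "\<dots> = real (totient D) ^ 3"
    by (simp add: totient_formula2 power_mult_distrib power3_eq_cube power2_eq_square)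
  finally show ?thesis by simp
qed

lemma sum_golden_powers_le_1:
  assumes "D > 0"
  shows "(\<Sum>e\<in>cofactor_divisors P D. (1 / golden ^ 2) ^ e) \<le> 1"
proof -
  have "cofactor_divisors P D \<subseteq> {1..D}"
    using assms by (auto simp: cofactor_divisors_def dvd_imp_le intro: Nat.gr0I)
  have g: "1 / golden ^ 2 \<le> 1 / 2" "1 / golden ^ 2 \<ge> 0"
    using golden_gt by (simp_all add: golden_square field_simps)
  have "(\<Sum>e\<in>cofactor_divisors P D. (1 / golden ^ 2) ^ e) \<le> (\<Sum>e\<in>{1..D}. (1 / golden ^ 2) ^ e)"
    using \<open>cofactor_divisors P D \<subseteq> {1..D}\<close> by (intro sum_mono2) auto
  also have "\<dots> \<le> (\<Sum>e\<in>{1..D}. (1 / 2) ^ e)"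
    using g by (intro sum_mono power_mono) auto
  also have "\<dots> = 1 - (1 / 2) ^ D"
    by (induction D) auto
  also have "\<dots> \<le> 1" by simp
  finally show ?thesis .
qed

text \<open>The constant is 3 * 9/8: 3 bounds e, and 9/8 comes from D^2 <= (9/8) totient(D)^3. From
  22 on, a cube grows per step by at most (23/22)^3 < 1.618.\<close>

lemma golden_power_gt_cube:
  assumes "N \<ge> 22"
  shows "27 / 8 * real N ^ 3 < golden ^ N"
  using assms
proof (induction N rule: nat_induct_at_least)
  case base
  have "27 / 8 * real 22 ^ 3 < (1.618 :: real) ^ 22" by (simp add: power_divide)
  also have "\<dots> \<le> golden ^ 22" using golden_gt by (intro power_mono) auto
  finally show ?case .
next
  case (Suc N)
  have "real (Suc N) ^ 3 \<le> (23 / 22 * real N) ^ 3"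
    using Suc.hyps by (intro power_mono) auto
  also have "\<dots> \<le> 1.618 * real N ^ 3" by (simp add: power_mult_distrib power_divide)
  finally have "27 / 8 * real (Suc N) ^ 3 \<le> 1.618 * (27 / 8 * real N ^ 3)" by simp
  also have "\<dots> < 1.618 * golden ^ N" using Suc.IH by simp
  also have "\<dots> \<le> golden * golden ^ N" using golden_gt by (intro mult_right_mono) auto
  finally show ?case by simp
qed

text \<open>The total logarithmic error is at most 1, which costs a factor e <= 3.\<close>

lemma fib_gt_Lcm_fib:
  fixes D :: nat
  assumes "odd D" and "totient D \<ge> 22"
  shows "D ^ 2 * Lcm ((\<lambda>r. fib (D div r)) ` prime_factors D) < fib D"
proof -
  define L where "L = Lcm ((\<lambda>r. fib (D div r)) ` prime_factors D)"
  have D: "D > 0" using assms by (auto intro: Nat.gr0I)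
  have "D \<noteq> 1" using assms by auto
  then have ne: "prime_factors D \<noteq> {}"
    using D by (metis empty_iff prime_factor_nat in_prime_factors_iff less_irrefl)
  have "L > 0" unfolding L_def using D by (intro Lcm_fib_pos) auto
  have "fib D > 0" using D by (rule fib_neq_0_nat)
  have "\<bar>ln (real (fib D)) - ln (real L)
      - (real D * (\<Prod>r\<in>prime_factors D. 1 - 1 / real r) * ln golden
         - (if prime_factors D = {} then ln (sqrt 5) else 0))\<bar>
    \<le> (\<Sum>e\<in>cofactor_divisors (prime_factors D) D. (1 / golden ^ 2) ^ e)"
    unfolding L_def using assms(1) by (intro ln_fib_Lcm_approx) auto
  also have "\<dots> \<le> 1" by (rule sum_golden_powers_le_1[OF D])
  finally have "ln (real (fib D)) \<ge> ln (real L) + real (totient D) * ln golden - 1"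
    using ne unfolding totient_formula2 by (simp add: abs_le_iff)
  then have "ln (golden ^ totient D * real L) \<le> ln (exp 1 * real (fib D))"
    using \<open>L > 0\<close> \<open>fib D > 0\<close> by (simp add: ln_mult_pos ln_realpow)
  then have "golden ^ totient D * real L \<le> exp 1 * real (fib D)"
    using \<open>L > 0\<close> \<open>fib D > 0\<close> by (subst (asm) ln_le_cancel_iff) auto
  also have "\<dots> \<le> 3 * real (fib D)"
    using exp_le by (intro mult_right_mono) auto
  finally have "golden ^ totient D * real L \<le> 3 * real (fib D)" .
  moreover have "3 * real D ^ 2 < golden ^ totient D"
    using golden_power_gt_cube[OF assms(2)] odd_totient_cube_ge[OF assms(1)] by simp
  then have "3 * real D ^ 2 * real L < golden ^ totient D * real L"
    using \<open>L > 0\<close> by simp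
  ultimately have "real (D ^ 2 * L) < real (fib D)" by simp
  then show ?thesis unfolding L_def by linarith
qed

subsection \<open>Composite and prime indices\<close>

lemma odd_totient_less_22:
  assumes "odd D" and "totient D < 22"
  shows "D \<in> {1,3,5,7,9,11,13,15,17,19,21,25,27,33}"
proof -
  have "8 * real D ^ 2 \<le> 9 * real (totient D) ^ 3" by (rule odd_totient_cube_ge[OF assms(1)])
  also have "\<dots> \<le> 9 * 21 ^ 3" using assms(2) by (intro mult_left_mono power_mono) auto
  \<comment> \<open>9 * 21^3 / 8 is about 10419, below 103^2 = 10609; what remains is a finite
    check.\<close>
  finally have "real D ^ 2 < 103 ^ 2" by simp
  then have "real D < 103" by (rule power_less_imp_less_base) simp
  then have "D < 103" by simp
  moreover obtain i where i: "D = 2 * i + 1" using assms(1) by (rule oddE)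
  ultimately have "i \<in> set [0..<52]" by simp
  moreover have "\<forall>i\<in>set [0..<52]. totient (2 * i + 1) < 22 \<longrightarrow>
      2 * i + 1 \<in> set [1,3,5,7,9,11,13,15,17,19,21,25,27,33]"
    by code_simp
  ultimately have "D \<in> set [1,3,5,7,9,11,13,15,17,19,21,25,27,33]"
    using assms(2) unfolding i by blast
  then show ?thesis by simp
qed

text \<open>The accumulator recursion, restated for numeral indices so that rewriting evaluates
  Fibonacci numbers in linearly many steps.\<close>

lemma gen_fib_rec:
  assumes "n \<ge> 2"
  shows "gen_fib a b n = gen_fib b (a + b) (n - 1)"
proof -
  obtain m where "n = Suc (Suc m)"
    using assms by (metis One_nat_def Suc_1 Suc_le_D Suc_le_mono)
  then show ?thesis by simp
qed

lemma gen_fib_1: "gen_fib a b 1 = b"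
  by simp

lemma fib_values:
  "fib 3 = 2" "fib 5 = 5" "fib 7 = 13" "fib 9 = 34" "fib 11 = 89" "fib 13 = 233" "fib 15 = 610"
  "fib 17 = 1597" "fib 19 = 4181" "fib 21 = 10946" "fib 25 = 75025" "fib 27 = 196418"
  "fib 33 = 3524578"
  by (simp_all add: fib_conv_gen_fib gen_fib_rec gen_fib_1 flip: One_nat_def)
    
lemma composite_not_fib_dvd_sum:
  fixes n :: nat
  assumes "n > 1" and n4: "n mod 4 = 1" and "n \<notin> {9, 25}" and "\<not> prime n"
  shows "\<not> fib n dvd (\<Sum>k=1..n-1. fib (k * n) div fib k)"
proof
  assume dvd: "fib n dvd (\<Sum>k=1..n-1. fib (k * n) div fib k)"
  define p where "p = (LEAST q. prime q \<and> q dvd n)"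
  have "\<exists>q. prime q \<and> q dvd n" using \<open>n > 1\<close> prime_factor_nat[of n] by auto
  then have "prime p \<and> p dvd n" unfolding p_def by (rule LeastI_ex)
  then have p: "prime p" "p dvd n" by auto
  have least: "p \<le> q" if "prime q" "q dvd n" for q
    unfolding p_def using that by (intro Least_le) simp
  obtain D where n: "n = D * p" using p(2) by (metis dvdE mult.commute)
  have "odd n" using n4 by presburger
  then have "odd D" "odd p" using n by auto
  then have p3: "p \<ge> 3" using prime_ge_2_nat[OF p(1)] by (cases "p = 2") auto
  have "D \<noteq> 1" "D \<noteq> 0" using n \<open>\<not> prime n\<close> p(1) \<open>n > 1\<close> by auto
  then obtain q where "prime q" "q dvd D" using prime_factor_nat by blast
  \<comment> \<open>Minimality of \<open>p\<close> gives \<open>p \<le> D\<close>, so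
    \<open>D * (p - 1)\<close> stays below D^2.\<close>
  then have "p \<le> q" "q \<le> D" using least[of q] \<open>D \<noteq> 0\<close> by (auto simp: n dvd_imp_le)
  then have "p \<le> D" by simp
  have key: "fib D dvd L * (D * (p - 1))" if "\<And>e. e dvd D \<Longrightarrow> e < D \<Longrightarrow> fib e dvd L" for L
    using fib_dvd_of_fib_dvd_sum[OF p(1) n n4 that dvd] .
  show False
  proof (cases "totient D \<ge> 22")
    case True
    define L where "L = Lcm ((\<lambda>r. fib (D div r)) ` prime_factors D)"
    have "L > 0" unfolding L_def using \<open>D \<noteq> 0\<close> by (intro Lcm_fib_pos) auto
    have "fib D dvd L * (D * (p - 1))"
    proof (rule key)
      fix e assume e: "e dvd D" "e < D"
      then obtain c where c: "D = e * c" by (elim dvdE)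
      then have "c \<noteq> 1" "c \<noteq> 0" using e \<open>D \<noteq> 0\<close> by auto
      then obtain r where r: "prime r" "r dvd c" using prime_factor_nat by blast
      \<comment> \<open>Every proper divisor of \<open>D\<close> divides some maximal one
        \<open>D div r\<close>, so the lcm over these suffices.\<close>
      then have "e dvd D div r" using c prime_gt_0_nat[of r] by (auto simp: div_mult_swap[symmetric])
      then have "fib e dvd fib (D div r)" by (rule fib_dvd_mono)
      also have "fib (D div r) dvd L"
        unfolding L_def using r c \<open>D \<noteq> 0\<close> by (intro dvd_Lcm imageI) (auto simp: in_prime_factors_iff)
      finally show "fib e dvd L" .
    qed
    then have "fib D \<le> L * (D * (p - 1))"
      using \<open>L > 0\<close> \<open>D \<noteq> 0\<close> p3 by (intro dvd_imp_le) auto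
    also have "\<dots> \<le> L * (D * D)" using \<open>p \<le> D\<close> by (intro mult_le_mono) auto
    also have "\<dots> < fib D"
      using fib_gt_Lcm_fib[OF \<open>odd D\<close> True] unfolding L_def by (simp add: power2_eq_square mult_ac)
    finally show False by simp
  next
    case False
    have small: "fib D \<le> L * (D * (p - 1))" if "L > 0" "\<forall>e\<in>set [0..<D]. e dvd D \<longrightarrow> fib e dvd L" for L
      using key[of L] that \<open>D \<noteq> 0\<close> p3 by (intro dvd_imp_le) auto
    have three: "p = 3" if "3 dvd D" using least[of 3] p3 that n by simp
    have five: "p \<le> 5" if "5 dvd D" using least[of 5] that n by simp
    consider "D = 3" | "D = 9" | "D = 15" | "D = 21" | "D = 27" | "D = 33" | "D = 5" | "D = 25"
      | "D = 7" | "D = 11" | "D = 13" | "D = 17" | "D = 19"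
      using odd_totient_less_22[OF \<open>odd D\<close>] False \<open>D \<noteq> 1\<close> by auto
    then show False
    proof cases
      case 1
      then show False using three n \<open>n \<notin> {9, 25}\<close> by simp
    next
      case 2
      then show False using three n n4 by simp
    next
      case 3
      \<comment> \<open>Here 10 = lcm(F_1, F_3, F_5); the constants in the later cases arise
        likewise from the proper divisors of \<open>D\<close>.\<close>
      have "\<forall>e\<in>set [0..<15]. e dvd 15 \<longrightarrow> fib e dvd 10" "fib 15 = 610" by (simp_all add: upt_conv_Cons fib_values flip: One_nat_def del: set_upt)
      then show False using small[of 10] three 3 by simp
    next
      case 4
      have "\<forall>e\<in>set [0..<21]. e dvd 21 \<longrightarrow> fib e dvd 26" "fib 21 = 10946" by (simp_all add: upt_conv_Cons fib_values flip: One_nat_def del: set_upt)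
      then show False using small[of 26] three 4 by simp
    next
      case 5
      have "\<forall>e\<in>set [0..<27]. e dvd 27 \<longrightarrow> fib e dvd 34" "fib 27 = 196418" by (simp_all add: upt_conv_Cons fib_values flip: One_nat_def del: set_upt)
      then show False using small[of 34] three 5 by simp
    next
      case 6
      have "\<forall>e\<in>set [0..<33]. e dvd 33 \<longrightarrow> fib e dvd 178" "fib 33 = 3524578" by (simp_all add: upt_conv_Cons fib_values flip: One_nat_def del: set_upt)
      then show False using small[of 178] three 6 by simp
    next
      case 7
      then have "p = 3 \<or> p = 5" using five p3 \<open>odd p\<close> by (cases "p = 4") auto
      \<comment> \<open>The candidates are 15, which is 3 modulo 4, and the excluded 25.\<close>
      then show False using 7 n n4 \<open>n \<notin> {9, 25}\<close> by auto
    next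
      case 8
      have "\<forall>e\<in>set [0..<25]. e dvd 25 \<longrightarrow> fib e dvd 5" "fib 25 = 75025" by (simp_all add: upt_conv_Cons fib_values flip: One_nat_def del: set_upt)
      then show False using small[of 5] five 8 by simp
    next
      case 9
      have "\<forall>e\<in>set [0..<7]. e dvd 7 \<longrightarrow> fib e dvd 1" "fib 7 = 13" by (simp_all add: upt_conv_Cons fib_values flip: One_nat_def del: set_upt)
      \<comment> \<open>For \<open>D = 7\<close> and \<open>D = 11\<close> size alone is not enough
        (13 <= 7 * 6, 89 <= 11 * 10); coprimality of F_D and D gives the contradiction.\<close>
      then have "13 dvd 7 * (p - 1)" using key[of 1] 9 by simp
      moreover have "coprime 13 (7 :: nat)" by (simp add: coprime_iff_gcd_eq_1 gcd_non_0_nat)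
      ultimately have "13 dvd p - 1" by (simp add: coprime_dvd_mult_right_iff)
      then show False using \<open>p \<le> D\<close> p3 9 by (auto dest: dvd_imp_le)
    next
      case 10
      have "\<forall>e\<in>set [0..<11]. e dvd 11 \<longrightarrow> fib e dvd 1" "fib 11 = 89" by (simp_all add: upt_conv_Cons fib_values flip: One_nat_def del: set_upt)
      then have "89 dvd 11 * (p - 1)" using key[of 1] 10 by simp
      moreover have "coprime 89 (11 :: nat)" by (simp add: coprime_iff_gcd_eq_1 gcd_non_0_nat)
      ultimately have "89 dvd p - 1" by (simp add: coprime_dvd_mult_right_iff)
      then show False using \<open>p \<le> D\<close> p3 10 by (auto dest: dvd_imp_le)
    next
      case 11
      have "\<forall>e\<in>set [0..<13]. e dvd 13 \<longrightarrow> fib e dvd 1" "fib 13 = 233" by (simp_all add: upt_conv_Cons fib_values flip: One_nat_def del: set_upt)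
      then show False using small[of 1] \<open>p \<le> D\<close> 11 by simp
    next
      case 12
      have "\<forall>e\<in>set [0..<17]. e dvd 17 \<longrightarrow> fib e dvd 1" "fib 17 = 1597" by (simp_all add: upt_conv_Cons fib_values flip: One_nat_def del: set_upt)
      then show False using small[of 1] \<open>p \<le> D\<close> 12 by simp
    next
      case 13
      have "\<forall>e\<in>set [0..<19]. e dvd 19 \<longrightarrow> fib e dvd 1" "fib 19 = 4181" by (simp_all add: upt_conv_Cons fib_values flip: One_nat_def del: set_upt)
      then show False using small[of 1] \<open>p \<le> D\<close> 13 by simp
    qed
  qed
qed

lemma prime_fib_dvd_sum:
  assumes "prime n"
  shows "fib n dvd (\<Sum>k=1..n-1. fib (k * n) div fib k)"
proof (rule dvd_sum)
  fix k assume "k \<in> {1..n-1}"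
  then have k: "k > 0" "k < n" by auto
  then have "gcd k n = 1"
    using assms by (metis coprime_commute coprime_imp_gcd_eq_1 nat_dvd_not_less prime_imp_coprime)
  then show "fib n dvd fib (k * n) div fib k"
    using fib_dvd_quotient_mult_fib_gcd[OF k(1), of n] by simp
qed

theorem theorem4p6:
  fixes n :: nat
  assumes "n > 1" and "[n = 1] (mod 4)" and "n \<notin> {9, 25}"
  shows "[(\<Sum>k=1..n-1. fib (k * n) div fib k) = 0] (mod fib n) \<longleftrightarrow> prime n"
proof -
  have "n mod 4 = 1" using assms(2) by (simp add: cong_def)
  then show ?thesis
    unfolding cong_0_iff
    using composite_not_fib_dvd_sum[of n] prime_fib_dvd_sum[of n] assms by blast
qed

end
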